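(* Let $d\in\mathbb N$, $T>0$, $p\in[0,\infty]$, and let $R\equiv K_Rh^p$ with a constant $K_R>0$ independent of $h$ (with $K_Rh^\infty:=0$). Consider the covariance recursion of the Gaussian ODE filter with $q=1$ and integrated Brownian motion prior (defined in the context) with step size $h>0$, $T/h\in\mathbb N$. Assume that the initial covariance satisfies $\|P(0)_{k,l}\|\le K_0h^{3-k-l}$ for all $k,l\in\{0,1\}$, where $K_0>0$ is a constant independent of $h$. Then there is a constant $K(T)>0$, independent of $h$, such that for all sufficiently small $h>0$, in every coordinate, $$\max_{n\in\{1,\dots,T/h\}}P^-_{00}(nh)\le K(T)\,h^{(p+1)\wedge2}\qquad\text{and}\qquad\max_{n\in\{0,\dots,T/h\}}P_{00}(nh)\le K(T)\,h^{(p+1)\wedge2}.$$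
   Context: Indices start at $0$; $a\wedge b=\min(a,b)$. For each coordinate $j\in\{0,\dots,d-1\}$ fix $\sigma_j>0$ and put $$A(h)=\begin{pmatrix}1&h\\ 0&1\end{pmatrix},\qquad Q_j(h)=\sigma_j^2\begin{pmatrix}h^3/3&h^2/2\\ h^2/2&h\end{pmatrix}.$$ Starting from symmetric positive semidefinite $P_j(0)\in\mathbb R^{2\times2}$ (which may depend on $h$), define for $n=0,1,2,\dots$ $$P_j^-((n+1)h)=A(h)P_j(nh)A(h)^\intercal+Q_j(h),$$ $$P_j((n+1)h)=P_j^-((n+1)h)-\frac{P_j^-((n+1)h)_{:,1}\,P_j^-((n+1)h)_{1,:}}{P_j^-((n+1)h)_{11}+R}.$$ $P(t)_{k,l}\in\mathbb R^d$ (also written $P_{kl}(t)$) denotes the vector with components $(P_j(t))_{k,l}$, similarly for $P^-$; $\|\cdot\|$ is a fixed norm on $\mathbb R^d$. Inequalities for $P_{00}$ and $P_{00}^-$ are meant coordinatewise in $j$. *)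

theory Defs
  imports "HOL-Analysis.Analysis"
begin

text \<open>
  The index type \<open>2\<close> has exactly the elements \<open>0\<close> and \<open>1\<close>, so \<open>M $ k $ l\<close> with
  \<open>k, l \<in> {0, 1}\<close> uses indices starting at \<open>0\<close>.  The library's \<open>vector [a, b]\<close> would place
  \<open>a\<close> at index \<open>1\<close> and \<open>b\<close> at index \<open>2 = 0\<close>, so it is not used here.
\<close>

definition mat22 :: "real \<Rightarrow> real \<Rightarrow> real \<Rightarrow> real \<Rightarrow> real^2^2" where
  "mat22 a b c d =
    (\<chi> k l. if k = 0 then (if l = 0 then a else b) else (if l = 0 then c else d))"

definition trans_mat :: "real \<Rightarrow> real^2^2" where
  "trans_mat h = mat22 1 h 0 1"

definition noise_mat :: "real \<Rightarrow> real \<Rightarrow> real^2^2" where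
  "noise_mat \<sigma> h = \<sigma>\<^sup>2 *\<^sub>R mat22 (h^3 / 3) (h\<^sup>2 / 2) (h\<^sup>2 / 2) h"

definition predict :: "real \<Rightarrow> real \<Rightarrow> real^2^2 \<Rightarrow> real^2^2" where
  "predict \<sigma> h P = trans_mat h ** P ** transpose (trans_mat h) + noise_mat \<sigma> h"

definition correct :: "real \<Rightarrow> real^2^2 \<Rightarrow> real^2^2" where
  "correct R M = M - (\<chi> k l. column 1 M $ k * row 1 M $ l / (M $ 1 $ 1 + R))"

text \<open>\<open>filter_cov \<sigma> h R P0 n\<close> is the covariance at time \<open>n * h\<close>, started at \<open>P0\<close>.\<close>

primrec filter_cov :: "real \<Rightarrow> real \<Rightarrow> real \<Rightarrow> real^2^2 \<Rightarrow> nat \<Rightarrow> real^2^2" where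
  "filter_cov \<sigma> h R P0 0 = P0"
| "filter_cov \<sigma> h R P0 (Suc n) = correct R (predict \<sigma> h (filter_cov \<sigma> h R P0 n))"

text \<open>The predicted covariance at time \<open>n * h\<close>; only meaningful for \<open>n \<ge> 1\<close>.\<close>

definition pred_cov :: "real \<Rightarrow> real \<Rightarrow> real \<Rightarrow> real^2^2 \<Rightarrow> nat \<Rightarrow> real^2^2" where
  "pred_cov \<sigma> h R P0 n = predict \<sigma> h (filter_cov \<sigma> h R P0 (n - 1))"

definition sym_psd :: "real^'n^'n \<Rightarrow> bool" where
  "sym_psd M \<longleftrightarrow> transpose M = M \<and> (\<forall>v. 0 \<le> v \<bullet> (M *v v))"

definition is_norm :: "('a::real_vector \<Rightarrow> real) \<Rightarrow> bool" where
  "is_norm N \<longleftrightarrow>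
    (\<forall>x. 0 \<le> N x) \<and> (\<forall>x. N x = 0 \<longleftrightarrow> x = 0) \<and>
    (\<forall>a x. N (a *\<^sub>R x) = \<bar>a\<bar> * N x) \<and> (\<forall>x y. N (x + y) \<le> N x + N y)"

text \<open>
  The power \<open>h\<^sup>p\<close> for \<open>p \<in> [0, \<infinity>]\<close> and \<open>h > 0\<close>, with the convention \<open>h\<^sup>\<infinity> = 0\<close>
  for every \<open>h\<close>.
\<close>

definition epow :: "real \<Rightarrow> ennreal \<Rightarrow> real" where
  "epow h p = (if p = \<infinity> then 0 else h powr enn2real p)"

end

theory Submission
  imports Defs
begin

text \<open>
  Write \<open>P00, P01, P11\<close> for the entries of a symmetric covariance.  A correction step never
  increases \<open>P00\<close> and leaves \<open>P11 \<le> R\<close>, so only growth in the prediction step matters; the latter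
  is controlled once \<open>P01\<close> is.  The point is that the gain makes \<open>P01 \<le> h R\<close> invariant exactly:
  \<open>R (h R + h P11 + \<sigma>\<^sup>2 h\<^sup>2 / 2) / (P11 + \<sigma>\<^sup>2 h + R) \<le> h R\<close>.  Allowing for the initial covariance,
  \<open>P01 \<le> h R + C h\<^sup>2\<close> and \<open>P11 \<le> R + C h\<close>, hence \<open>P00\<close> grows by at most \<open>O(h\<^sup>2 R + h\<^sup>3)\<close> per
  step and by \<open>O(h R + h\<^sup>2)\<close> over \<open>T / h\<close> steps.
\<close>

section \<open>Matrix entries and bounds for a single step\<close>

lemma UNIV_2_eq: "(UNIV :: 2 set) = {0, 1}"
proof -
  have "(2::2) = 0"
    by simp
  then show ?thesis
    using UNIV_2 by auto
qed

lemma sum_UNIV_2: "sum f (UNIV :: 2 set) = f 0 + f 1"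
  by (simp add: UNIV_2_eq)

lemma predict_nth:
  "predict \<sigma> h P $ 0 $ 0 = P$0$0 + h * (P$0$1 + P$1$0) + h\<^sup>2 * P$1$1 + \<sigma>\<^sup>2 * h^3 / 3"
  "predict \<sigma> h P $ 0 $ 1 = P$0$1 + h * P$1$1 + \<sigma>\<^sup>2 * h\<^sup>2 / 2"
  "predict \<sigma> h P $ 1 $ 0 = P$1$0 + h * P$1$1 + \<sigma>\<^sup>2 * h\<^sup>2 / 2"
  "predict \<sigma> h P $ 1 $ 1 = P$1$1 + \<sigma>\<^sup>2 * h"
  by (simp_all add: predict_def trans_mat_def noise_mat_def mat22_def matrix_matrix_mult_def
      transpose_def sum_UNIV_2 algebra_simps power2_eq_square)

lemma correct_nth:
  "correct R M $ k $ l = M$k$l - M$k$1 * M$1$l / (M$1$1 + R)"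
  by (simp add: correct_def column_def row_def)

lemma sym_psd_diag_nonneg:
  assumes "sym_psd M"
  shows "M$i$i \<ge> 0"
proof -
  have "0 \<le> axis i 1 \<bullet> (M *v axis i 1)"
    using assms by (simp add: sym_psd_def)
  then show ?thesis
    by (simp add: inner_axis' matrix_vector_mult_basis column_def)
qed

lemma sym_psd_sym:
  assumes "sym_psd M"
  shows "M$i$j = M$j$i"
proof -
  have "transpose M $ i $ j = M $ i $ j"
    using assms by (simp add: sym_psd_def)
  then show ?thesis
    by (simp add: transpose_def)
qed

text \<open>Here \<open>b\<close> and \<open>c\<close> are the entries 01 and 11 of a covariance,
  \<open>s\<close> is the squared diffusion, and the correction multiplies column 1 of the
  prediction by \<open>g\<close>. The denominator of \<open>g\<close> cancels the bracket in
  \<open>h * (c + s * h + R)\<close>, leaving exactly \<open>h * R\<close>, while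
  \<open>g \<le> 1\<close> can only shrink the initial error \<open>C * h\<^sup>2\<close>. So the
  bound on entry 01 does not deteriorate from step to step.\<close>

lemma gain_bounds:
  fixes h R C s b c :: real
  assumes "h > 0" "R \<ge> 0" "C \<ge> 0" "s > 0" "c \<ge> 0" and b: "b \<le> h * R + C * h\<^sup>2"
  defines "g \<equiv> R / (c + s * h + R)"
  shows "0 \<le> (c + s * h) * g" "(c + s * h) * g \<le> R"
    and "(b + h * c + s * h\<^sup>2 / 2) * g \<le> h * R + C * h\<^sup>2"
proof -
  \<comment> \<open>The process noise keeps the denominator positive even for \<open>R = 0\<close>,
    the case of infinite \<open>p\<close>.\<close>
  have sh: "s * h > 0"
    using assms by simp
  then have pos: "c + s * h + R > 0"
    using assms by linarith
  have g: "0 \<le> g" "g \<le> 1" "(c + s * h + R) * g = R"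
    using assms sh pos by (simp_all add: g_def)
  show "0 \<le> (c + s * h) * g"
    using g sh assms by simp
  show "(c + s * h) * g \<le> R"
    using g(3) mult_nonneg_nonneg[OF \<open>R \<ge> 0\<close> g(1)] by (simp add: distrib_right)
  have "b + h * c + s * h\<^sup>2 / 2 \<le> h * (c + s * h + R) + C * h\<^sup>2"
  proof -
    have "0 \<le> s * h\<^sup>2"
      using assms by simp
    then show ?thesis
      using b by (simp add: algebra_simps power2_eq_square)
  qed
  then have "(b + h * c + s * h\<^sup>2 / 2) * g \<le> (h * (c + s * h + R) + C * h\<^sup>2) * g"
    using g by (intro mult_right_mono) auto
  also have "\<dots> = h * R + C * h\<^sup>2 * g"
  proof -
    have "(h * (c + s * h + R) + C * h\<^sup>2) * g = h * ((c + s * h + R) * g) + C * h\<^sup>2 * g"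
      by (simp add: algebra_simps)
    then show ?thesis
      by (simp only: g(3))
  qed
  also have "\<dots> \<le> h * R + C * h\<^sup>2"
    using mult_left_le[OF g(2), of "C * h\<^sup>2"] \<open>C \<ge> 0\<close> by simp
  finally show "(b + h * c + s * h\<^sup>2 / 2) * g \<le> h * R + C * h\<^sup>2" .
qed

text \<open>The factors 3 count two off-diagonal contributions and one from entry 11; the noise
  \<open>\<sigma>\<^sup>2 * h^3 / 3\<close> is rounded up.\<close>

lemma predict_00_le:
  assumes "h > 0" "P$0$1 = P$1$0" "P$0$1 \<le> h * R + C * h\<^sup>2" "P$1$1 \<le> R + C * h"
  shows "predict \<sigma> h P $ 0 $ 0 \<le> P$0$0 + (3 * h\<^sup>2 * R + (3 * C + \<sigma>\<^sup>2) * h^3)"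
proof -
  have "h * (P$0$1 + P$1$0) \<le> h * (2 * (h * R + C * h\<^sup>2))"
    using assms by (intro mult_left_mono) auto
  moreover have "h\<^sup>2 * P$1$1 \<le> h\<^sup>2 * (R + C * h)"
    using assms by (intro mult_left_mono) auto
  moreover have "\<sigma>\<^sup>2 * h^3 / 3 \<le> \<sigma>\<^sup>2 * h^3"
    using assms by simp
  ultimately show ?thesis
    unfolding predict_nth by (simp add: algebra_simps power2_eq_square power3_eq_cube)
qed

section \<open>Induction along the recursion in one coordinate\<close>

context
  fixes h R C \<sigma> :: real and P0 :: "real^2^2"
  assumes h: "h > 0" and R: "R \<ge> 0" and C: "C \<ge> 0" and \<sigma>: "\<sigma> > 0"
    and psd: "sym_psd P0"
    and init: "P0$0$0 \<le> C * h^3" "P0$0$1 \<le> C * h\<^sup>2" "P0$1$1 \<le> C * h"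
begin

text \<open>The bounds are free of \<open>n\<close>, which makes the later growth of entry 00 linear
  in \<open>n\<close>. Of positive semidefiniteness only symmetry and the sign of entry 11 are
  propagated: they keep the denominator positive and make the correction of entry 00 a square over
  it.\<close>

lemma filter_cov_invariant:
  defines "P \<equiv> filter_cov \<sigma> h R P0"
  shows "P n$0$1 = P n$1$0 \<and> 0 \<le> P n$1$1 \<and> P n$1$1 \<le> R + C * h \<and> P n$0$1 \<le> h * R + C * h\<^sup>2"
proof (induction n)
  case 0
  have "0 \<le> h * R"
    using h R by simp
  with init show ?case
    using sym_psd_sym[OF psd] sym_psd_diag_nonneg[OF psd] R unfolding P_def by fastforce
next
  case (Suc n)
  let ?c = "P n$1$1" and ?b = "P n$0$1"
  let ?g = "R / (?c + \<sigma>\<^sup>2 * h + R)"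
  have IH: "P n$1$0 = ?b" "0 \<le> ?c" "?b \<le> h * R + C * h\<^sup>2"
    using Suc by auto
  have s: "\<sigma>\<^sup>2 > 0"
    using \<sigma> by simp
  have pos: "?c + \<sigma>\<^sup>2 * h + R > 0"
    using IH R h s by (simp add: add_pos_nonneg add_nonneg_pos)
  \<comment> \<open>For an entry \<open>x\<close> in column 1 of the prediction, subtracting the
    correction amounts to scaling by \<open>?g\<close>; this serves both entries 11 and 01.\<close>
  have gain: "x - x * (?c + \<sigma>\<^sup>2 * h) / (?c + \<sigma>\<^sup>2 * h + R) = x * ?g" for x
    using pos by (simp add: field_simps)
  have "P (Suc n)$1$1 = (?c + \<sigma>\<^sup>2 * h) * ?g"
    unfolding gain[symmetric] by (simp add: P_def correct_nth predict_nth)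
  moreover have "P (Suc n)$0$1 = (?b + h * ?c + \<sigma>\<^sup>2 * h\<^sup>2 / 2) * ?g"
    unfolding gain[symmetric] by (simp add: P_def correct_nth predict_nth)
  moreover have "P (Suc n)$0$1 = P (Suc n)$1$0"
    using IH(1) by (simp add: P_def correct_nth predict_nth mult.commute)
  moreover have "R \<le> R + C * h"
    using C h by simp
  ultimately show ?case
    using gain_bounds[OF h R C s IH(2,3)] by linarith
qed

text \<open>By symmetry the correction subtracts the square of the predicted entry 01 over a
  nonnegative number.\<close>

lemma filter_cov_00_Suc_le: "filter_cov \<sigma> h R P0 (Suc n) $ 0 $ 0 \<le> pred_cov \<sigma> h R P0 (Suc n) $ 0 $ 0"
proof -
  let ?P = "filter_cov \<sigma> h R P0 n"
  have "predict \<sigma> h ?P $ 1 $ 1 \<ge> 0"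
    using filter_cov_invariant[of n] h by (simp add: predict_nth)
  moreover have "predict \<sigma> h ?P $ 0 $ 1 = predict \<sigma> h ?P $ 1 $ 0"
    using filter_cov_invariant[of n] by (simp add: predict_nth)
  ultimately show ?thesis
    using R by (simp add: correct_nth pred_cov_def)
qed

lemma pred_cov_00_Suc_le:
  "pred_cov \<sigma> h R P0 (Suc n) $ 0 $ 0
     \<le> filter_cov \<sigma> h R P0 n $ 0 $ 0 + (3 * h\<^sup>2 * R + (3 * C + \<sigma>\<^sup>2) * h^3)"
  using predict_00_le[OF h, of "filter_cov \<sigma> h R P0 n" R C \<sigma>] filter_cov_invariant[of n]
  by (simp add: pred_cov_def)

lemma filter_cov_00_le:
  "filter_cov \<sigma> h R P0 n $ 0 $ 0 \<le> C * h^3 + real n * (3 * h\<^sup>2 * R + (3 * C + \<sigma>\<^sup>2) * h^3)"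
proof (induction n)
  case 0
  show ?case using init by simp
next
  case (Suc n)
  then show ?case
    using filter_cov_00_Suc_le[of n] pred_cov_00_Suc_le[of n] by (simp add: algebra_simps)
qed

text \<open>The prediction at step \<open>n\<close> is one increment above the filter at step
  \<open>n - 1\<close>, so both obey the same linear bound.\<close>

lemma pred_cov_00_le:
  assumes "n \<ge> 1"
  shows "pred_cov \<sigma> h R P0 n $ 0 $ 0 \<le> C * h^3 + real n * (3 * h\<^sup>2 * R + (3 * C + \<sigma>\<^sup>2) * h^3)"
proof -
  obtain m where "n = Suc m"
    using assms by (cases n) auto
  then show ?thesis
    using filter_cov_00_le[of m] pred_cov_00_Suc_le[of m] by (simp add: algebra_simps)
qed

end

section \<open>Comparison of an arbitrary norm with the Euclidean one\<close>

lemma is_norm_bounds_norm: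
  fixes N :: "'a::euclidean_space \<Rightarrow> real"
  assumes "is_norm N"
  obtains B where "B > 0" "\<And>x. norm x \<le> B * N x"
proof -
  have nonneg: "0 \<le> N x" and zero: "N x = 0 \<longleftrightarrow> x = 0" and scale: "N (a *\<^sub>R x) = \<bar>a\<bar> * N x"
    and tri: "N (x + y) \<le> N x + N y" for a x y
    using assms by (auto simp: is_norm_def)
  \<comment> \<open>\<open>L\<close> serves as a Lipschitz constant of \<open>N\<close> for the
    Euclidean norm. The resulting continuity gives \<open>N\<close> a minimum on the compact unit
    sphere.\<close>
  define L where "L = (\<Sum>i\<in>Basis. N i)"
  have sum_le: "N (sum f A) \<le> (\<Sum>i\<in>A. N (f i))" if "finite A" for f :: "'a \<Rightarrow> 'a" and A
    using that
  proof (induction A rule: finite_induct)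
    case empty
    show ?case using zero[of 0] by simp
  next
    case (insert i A)
    then show ?case using tri[of "f i" "sum f A"] by simp
  qed
  have upper: "N x \<le> L * norm x" for x
  proof -
    have "N x = N (\<Sum>i\<in>Basis. (x \<bullet> i) *\<^sub>R i)"
      by (simp add: euclidean_representation)
    also have "\<dots> \<le> (\<Sum>i\<in>Basis. \<bar>x \<bullet> i\<bar> * N i)"
      using sum_le[of Basis "\<lambda>i. (x \<bullet> i) *\<^sub>R i"] by (simp add: scale)
    also have "\<dots> \<le> (\<Sum>i\<in>Basis. norm x * N i)"
      by (intro sum_mono mult_right_mono nonneg) (auto simp: Basis_le_norm)
    finally show ?thesis
      by (simp add: L_def sum_distrib_left mult.commute)
  qed
  have lip: "\<bar>N x - N y\<bar> \<le> L * norm (x - y)" for x y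
  proof -
    have "N x \<le> N y + N (x - y)" "N y \<le> N x + N (y - x)"
      using tri[of y "x - y"] tri[of x "y - x"] by simp_all
    then show ?thesis
      using upper[of "x - y"] upper[of "y - x"] by (simp add: norm_minus_commute)
  qed
  have "L \<ge> 0"
    by (simp add: L_def nonneg sum_nonneg)
  then have "L-lipschitz_on UNIV N"
    using lip by (intro lipschitz_onI) (auto simp: dist_norm)
  then have "continuous_on (sphere 0 1) N"
    using continuous_on_subset lipschitz_on_continuous_on by blast
  moreover have "sphere (0::'a) 1 \<noteq> {}"
    by simp
  ultimately obtain z where z: "z \<in> sphere 0 1" "\<And>y. y \<in> sphere 0 1 \<Longrightarrow> N z \<le> N y"
    using continuous_attains_inf[of "sphere (0::'a) 1" N] compact_sphere by blast
  \<comment> \<open>The minimizer \<open>z\<close> lies on the unit sphere and is therefore nonzero;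
    rescaling any \<open>x\<close> to the sphere then gives the constant
    \<open>1 / N z\<close>.\<close>
  have Nz: "N z > 0"
    using nonneg[of z] zero[of z] z(1) by fastforce
  have "norm x \<le> (1 / N z) * N x" for x
  proof (cases "x = 0")
    case False
    have "N z \<le> N ((1 / norm x) *\<^sub>R x)"
      using False by (intro z(2)) simp
    also have "\<dots> = N x / norm x"
      by (simp add: scale)
    finally show ?thesis
      using False Nz by (simp add: field_simps)
  qed (use zero[of 0] in simp)
  then show thesis
    using Nz that[of "1 / N z"] by simp
qed

section \<open>Powers of the step size with possibly infinite exponent\<close>

lemma epow_nonneg: "0 \<le> epow h p"
  by (simp add: epow_def)

text \<open>For \<open>h \<le> 1\<close> a larger exponent gives a smaller power, and both 2 and
  \<open>p + 1\<close> are at least their minimum. For infinite \<open>p\<close> the minimum is 2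
  and \<open>epow h p\<close> vanishes.\<close>

lemma epow_rate_bounds:
  assumes "0 < h" "h \<le> 1"
  shows "h\<^sup>2 \<le> epow h (min (p + 1) 2)" "h * epow h p \<le> epow h (min (p + 1) 2)"
proof -
  have "h\<^sup>2 \<le> epow h (min (p + 1) 2) \<and> h * epow h p \<le> epow h (min (p + 1) 2)"
  proof (cases p)
    case (real r)
    have p1: "p + 1 = ennreal (r + 1)"
      using real by simp
    have "ennreal (r + 1) \<le> ennreal 2 \<longleftrightarrow> r \<le> 1"
      by (subst ennreal_le_iff) auto
    then have le: "p + 1 \<le> 2 \<longleftrightarrow> r \<le> 1"
      by (simp add: p1 del: ennreal_plus)
    have eq: "min (p + 1) 2 = ennreal (min (r + 1) 2)"
      unfolding min_def le by (simp add: p1 del: ennreal_plus)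
    have "h\<^sup>2 = h powr 2"
      using assms by (simp add: powr_numeral)
    moreover have "h * epow h p = h powr (r + 1)"
      using assms real by (simp add: epow_def powr_add mult.commute)
    moreover have "epow h (min (p + 1) 2) = h powr (min (r + 1) 2)"
      unfolding eq using real by (simp add: epow_def)
    moreover have "h powr 2 \<le> h powr (min (r + 1) 2)" "h powr (r + 1) \<le> h powr (min (r + 1) 2)"
      by (rule powr_mono'; use assms in simp)+
    ultimately show ?thesis
      by presburger
  next
    case top
    then have "min (p + 1) 2 = 2"
      by (simp add: min_absorb2)
    then show ?thesis
      using assms top by (simp add: epow_def powr_numeral)
  qed
  then show "h\<^sup>2 \<le> epow h (min (p + 1) 2)" "h * epow h p \<le> epow h (min (p + 1) 2)"
    by auto
qed

section \<open>Constants uniform in the step size and the coordinate\<close>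

theorem theorem15:
  fixes \<sigma> :: "'d::finite \<Rightarrow> real"
    and T K\<^sub>R K\<^sub>0 :: real
    and p :: ennreal
    and nrm :: "real^'d \<Rightarrow> real"
    and P0 :: "real \<Rightarrow> 'd \<Rightarrow> real^2^2"
  assumes "is_norm nrm"
    and "\<And>j. \<sigma> j > 0"
    and "T > 0" and "K\<^sub>R > 0" and "K\<^sub>0 > 0"
    and "\<And>h j. h > 0 \<Longrightarrow> T / h \<in> \<nat> \<Longrightarrow> sym_psd (P0 h j)"
    and "\<And>h k l. h > 0 \<Longrightarrow> T / h \<in> \<nat> \<Longrightarrow> k \<in> {0, 1} \<Longrightarrow> l \<in> {0, 1} \<Longrightarrow>
          nrm (\<chi> j. P0 h j $ of_nat k $ of_nat l) \<le> K\<^sub>0 * h ^ (3 - k - l)"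
  shows "\<exists>K>0. \<forall>\<^sub>F h in at_right 0. \<forall>N::nat. T / h = real N \<longrightarrow> (\<forall>j.
      (MAX n\<in>{1..N}. pred_cov (\<sigma> j) h (K\<^sub>R * epow h p) (P0 h j) n $ 0 $ 0)
        \<le> K * epow h (min (p + 1) 2) \<and>
      (MAX n\<in>{0..N}. filter_cov (\<sigma> j) h (K\<^sub>R * epow h p) (P0 h j) n $ 0 $ 0)
        \<le> K * epow h (min (p + 1) 2))"
proof -
  obtain B where B: "B > 0" "\<And>x. norm x \<le> B * nrm x"
    using is_norm_bounds_norm[OF assms(1)] by blast
  define C where "C = B * K\<^sub>0"
  \<comment> \<open>The sum dominates every squared diffusion, so one \<open>K\<close> works for all
    coordinates. In \<open>K\<close>, the summand \<open>C\<close> pays for the initial covariance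
    and the factor \<open>T\<close> for the accumulated increments.\<close>
  define S where "S = (\<Sum>j\<in>UNIV. (\<sigma> j)\<^sup>2)"
  define K where "K = C + T * (3 * K\<^sub>R + 3 * C + S)"
  have C: "C > 0"
    using B assms by (simp add: C_def)
  have S: "(\<sigma> j)\<^sup>2 \<le> S" for j
    unfolding S_def by (rule member_le_sum) auto
  have "S \<ge> 0"
    by (simp add: S_def sum_nonneg)
  then have K: "K > 0"
    using C assms by (simp add: K_def add_pos_nonneg)
  \<comment> \<open>A component is at most the Euclidean norm, which is at most \<open>B\<close>
    times the given norm; hence \<open>C = B * K\<^sub>0\<close>.\<close>
  have init: "P0 h j $ of_nat k $ of_nat l \<le> C * h ^ (3 - k - l)"
    if "h > 0" "T / h \<in> \<nat>" "k \<in> {0, 1}" "l \<in> {0, 1}" for h j and k l :: nat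
  proof -
    let ?v = "\<chi> j. P0 h j $ of_nat k $ of_nat l"
    have "?v $ j \<le> norm ?v"
      using component_le_norm_cart[of ?v j] by linarith
    also have "\<dots> \<le> B * nrm ?v"
      by (rule B)
    also have "\<dots> \<le> B * (K\<^sub>0 * h ^ (3 - k - l))"
      using B assms(7)[OF that] by (intro mult_left_mono) auto
    finally show ?thesis
      by (simp add: C_def)
  qed
  have bound: "C * h^3 + real n * (3 * h\<^sup>2 * (K\<^sub>R * epow h p) + (3 * C + (\<sigma> j)\<^sup>2) * h^3)
      \<le> K * epow h (min (p + 1) 2)"
    if h: "0 < h" "h \<le> 1" and n: "real n * h \<le> T" for h n j
  proof -
    let ?E = "epow h (min (p + 1) 2)"
    have E: "h\<^sup>2 \<le> ?E" "h * epow h p \<le> ?E"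
      using epow_rate_bounds[OF h] by auto
    have "h^3 \<le> h\<^sup>2"
      using h by (intro power_decreasing) auto
    then have *: "C * h^3 \<le> C * ?E"
      using E C by (intro mult_left_mono) auto
    \<comment> \<open>One factor \<open>h\<close> is paired with \<open>n\<close> and absorbed by
      \<open>real n * h \<le> T\<close>; what remains is of order \<open>h * epow h p\<close> and
      \<open>h\<^sup>2\<close>, the two rates already compared with the target.\<close>
    have "real n * (3 * h\<^sup>2 * (K\<^sub>R * epow h p) + (3 * C + (\<sigma> j)\<^sup>2) * h^3)
        = (real n * h) * (3 * K\<^sub>R * (h * epow h p) + (3 * C + (\<sigma> j)\<^sup>2) * h\<^sup>2)"
      by (simp add: algebra_simps power2_eq_square power3_eq_cube)
    also have "\<dots> \<le> T * (3 * K\<^sub>R * ?E + (3 * C + S) * ?E)"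
      using h n E S[of j] C assms epow_nonneg[of h p] \<open>S \<ge> 0\<close>
      by (intro mult_mono add_mono) auto
    finally show ?thesis
      using * by (simp add: K_def algebra_simps)
  qed
  \<comment> \<open>Sufficiently small means \<open>h < 1\<close>, where powers decrease in the
    exponent.\<close>
  have "\<forall>\<^sub>F h in at_right (0::real). 0 < h \<and> h < 1"
    using eventually_at_right_less[of "0::real"] eventually_at_right_real[of 0 1]
    by (auto elim: eventually_mono)
  then have "\<forall>\<^sub>F h in at_right 0. \<forall>N::nat. T / h = real N \<longrightarrow> (\<forall>j.
      (MAX n\<in>{1..N}. pred_cov (\<sigma> j) h (K\<^sub>R * epow h p) (P0 h j) n $ 0 $ 0)
        \<le> K * epow h (min (p + 1) 2) \<and>
      (MAX n\<in>{0..N}. filter_cov (\<sigma> j) h (K\<^sub>R * epow h p) (P0 h j) n $ 0 $ 0)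
        \<le> K * epow h (min (p + 1) 2))"
  proof (rule eventually_mono, intro allI impI)
    fix h N j
    assume "0 < h \<and> h < 1" and N: "T / h = real N"
    then have h: "0 < h" "h \<le> 1"
      by auto
    have Nat: "T / h \<in> \<nat>"
      using N by simp
    \<comment> \<open>This makes \<open>{1..N}\<close> nonempty, so that \<open>MAX\<close> over it
      is a genuine maximum.\<close>
    have "N \<noteq> 0"
      using N h assms(3) by (intro notI) simp
    have nh: "real n * h \<le> T" if "n \<le> N" for n
    proof -
      have "real n * h \<le> real N * h"
        using that h by simp
      also have "\<dots> = T"
        using N h by (simp add: field_simps)
      finally show ?thesis .
    qed
    have R: "0 \<le> K\<^sub>R * epow h p"
      using assms epow_nonneg by simp
    have i: "P0 h j$0$0 \<le> C * h^3" "P0 h j$0$1 \<le> C * h\<^sup>2" "P0 h j$1$1 \<le> C * h"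
      using init[OF h(1) Nat, of 0 0 j] init[OF h(1) Nat, of 0 1 j] init[OF h(1) Nat, of 1 1 j]
      by simp_all
    note hyps = h(1) R less_imp_le[OF C] assms(2)[of j] assms(6)[OF h(1) Nat] i
    have "pred_cov (\<sigma> j) h (K\<^sub>R * epow h p) (P0 h j) n $ 0 $ 0 \<le> K * epow h (min (p + 1) 2)"
      if "n \<in> {1..N}" for n
      using pred_cov_00_le[OF hyps, of n] bound[OF h nh[of n], of j] that by force
    moreover have "filter_cov (\<sigma> j) h (K\<^sub>R * epow h p) (P0 h j) n $ 0 $ 0
        \<le> K * epow h (min (p + 1) 2)" if "n \<in> {0..N}" for n
      using filter_cov_00_le[OF hyps, of n] bound[OF h nh[of n], of j] that by force
    ultimately show "(MAX n\<in>{1..N}. pred_cov (\<sigma> j) h (K\<^sub>R * epow h p) (P0 h j) n $ 0 $ 0)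
        \<le> K * epow h (min (p + 1) 2) \<and>
      (MAX n\<in>{0..N}. filter_cov (\<sigma> j) h (K\<^sub>R * epow h p) (P0 h j) n $ 0 $ 0)
        \<le> K * epow h (min (p + 1) 2)"
      using \<open>N \<noteq> 0\<close> by (intro conjI Max.boundedI) auto
  qed
  with K show ?thesis
    by blast
qed

end
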